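(* Let $S,\lambda>0$, $\mu>\lambda$ and $\bar{x}\in(0,1)$ be given. The stationary Fokker–Planck system for $(p_N,p_W)$ on $D=[0,1]$ described in the context admits a solution with $p_W,p_N\in C(0,1)$, with $$p_N(+0)=\frac{\lambda}{S}c_N,\qquad p_W(+0)=\frac{\mu}{S}c_W-\frac{\lambda}{S}c_N$$ (where $c_N,c_W\ge0$ are the weights of the Dirac masses of $p_N,p_W$ at $x=0$), and with $\int_D(p_N+p_W)\,dx=1$ (Dirac masses at $0$ included). They are expressed as $$p_N(x)=\begin{cases}\mu\lambda^{-1}c\,e^{-\lambda S^{-1}\bar{x}}\,\delta_{\{x=0\}} & (x=0),\\ \mu S^{-1}c\,e^{\lambda S^{-1}(x-\bar{x})} & (0<x\le\bar{x}),\\ \mu S^{-1}c\,(1-\chi_{\{x=1\}}) & (\bar{x}<x\le1),\end{cases}$$ $$p_W(x)=\begin{cases}E c\,\delta_{\{x=0\}} & (x=0),\\ F c\left(e^{\lambda S^{-1}(x-\bar{x})}-e^{\mu S^{-1}(x-\bar{x})}\right) & (0<x\le\bar{x}),\\ 0 & (\bar{x}<x\le1),\end{cases}$$ with $$E=\frac{\mu e^{-\lambda S^{-1}\bar{x}}-\lambda e^{-\mu S^{-1}\bar{x}}}{\mu-\lambda}>0,\qquad F=\frac{\lambda\mu}{S(\mu-\lambda)}>0,\qquad c=\frac{1}{1+\mu\lambda^{-1}+\mu S^{-1}(1-\bar{x})}>0.$$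
   Context: $\chi_E$ denotes an indicator function and $\delta_{\{x=y\}}$ the Dirac delta concentrated at $x=y$. The unknowns $p_N$ and $p_W$ (densities of the "non-waiting" and "waiting" cases) are functions on $(0,1]$, each possibly supplemented by a Dirac mass at $x=0$: $c_N\delta_{\{x=0\}}$ for $p_N$ and $c_W\delta_{\{x=0\}}$ for $p_W$. In the formulas of the claim, the line "$(x=0)$" specifies this Dirac mass at $0$. The flux is $F_a=-S\chi_{\{x>0\}}p_a$ ($a=N,W$) inside the domain, and it vanishes at the boundary points $x=0,1$. The Fokker–Planck system is $$\frac{dF_N}{dx}+\lambda p_N=0\quad\text{for }x\in[0,\bar{x}],$$ $$\frac{dF_N}{dx}-\mu c\,\delta_{\{x=1\}}=0\quad\text{for }x\in(\bar{x},1],\qquad c=\int_{[0,1]}p_W(x)\,dx,$$ $$\frac{dF_W}{dx}+\mu p_W-\lambda p_N=0\quad\text{for }x\in[0,\bar{x}],$$ $$p_W(x)=0\ \text{ for }x\in(\bar{x},1],\qquad p_N(1)=0.$$ The integral of $p_W$ defining $c$ includes the Dirac mass at $0$. Interpretation at the boundary points: near $x=0$ the first and third equations are understood in integral form over $[0,h]$, $h\to+0$, with zero flux at $x=0$; this is exactly the pair of relations $p_N(+0)=\frac{\lambda}{S}c_N$ and $p_W(+0)=\frac{\mu}{S}c_W-\frac{\lambda}{S}c_N$. At $x=1$ the Dirac source together with zero flux at $x=1$ means that $S\,p_N(1-0)=\mu c$. In the interiors $(0,\bar{x})$ and $(\bar{x},1)$ the equations hold in the classical sense. *)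

theory Defs
  imports "HOL-Analysis.Analysis"
begin

text \<open>
  A density on $[0,1]$ with a possible Dirac mass at $0$ is encoded as a pair of a weight
  \<open>w\<close> (the mass at $0$) and a function \<open>p\<close>, of which only the values on $(0,1]$ matter.
  \<open>mass w p h\<close> is its total mass on $[0,h]$, Dirac mass included.
\<close>

definition mass :: "real \<Rightarrow> (real \<Rightarrow> real) \<Rightarrow> real \<Rightarrow> real" where
  "mass w p h = w + (LINT x:{0<..h}|lborel. p x)"

text \<open>The indicator function also encodes that the flux vanishes at $x=0$ and $x=1$.\<close>

definition flux :: "real \<Rightarrow> (real \<Rightarrow> real) \<Rightarrow> real \<Rightarrow> real" where
  "flux S p x = - S * indicator {0<..<1} x * p x"

text \<open>
  Inside $(0,\bar x)$ and $(\bar x,1)$ the equations are classical. At $x=0$ they are read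
  in integral form over $[0,h]$ as $h\to+0$. The source $\mu c\,\delta_{\{x=1\}}$ with
  $c=\int_{[0,1]}p_W$ does not contribute inside $(\bar x,1)$; together with the zero flux
  at $x=1$ it means $S\,p_N(1-0)=\mu c$. Integrability is required because the Lebesgue
  integral of a non-integrable function is $0$ by convention.
\<close>

definition stationary_fokker_planck ::
  "real \<Rightarrow> real \<Rightarrow> real \<Rightarrow> real \<Rightarrow> real \<Rightarrow> (real \<Rightarrow> real) \<Rightarrow> real \<Rightarrow> (real \<Rightarrow> real) \<Rightarrow> bool"
  where
  "stationary_fokker_planck S lam mu xbar cN pN cW pW \<longleftrightarrow>
     set_integrable lborel {0<..1} pN \<and> set_integrable lborel {0<..1} pW \<and>
     (\<forall>x\<in>{0<..<xbar}. \<exists>D. (flux S pN has_real_derivative D) (at x) \<and> D + lam * pN x = 0) \<and>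
     ((\<lambda>h. flux S pN h - flux S pN 0 + lam * mass cN pN h) \<longlongrightarrow> 0) (at_right 0) \<and>
     (\<forall>x\<in>{xbar<..<1}. (flux S pN has_real_derivative 0) (at x)) \<and>
     ((\<lambda>x. S * pN x) \<longlongrightarrow> mu * mass cW pW 1) (at_left 1) \<and>
     (\<forall>x\<in>{0<..<xbar}. \<exists>D. (flux S pW has_real_derivative D) (at x) \<and>
                            D + mu * pW x - lam * pN x = 0) \<and>
     ((\<lambda>h. flux S pW h - flux S pW 0 + mu * mass cW pW h - lam * mass cN pN h) \<longlongrightarrow> 0)
       (at_right 0) \<and>
     (\<forall>x\<in>{xbar<..1}. pW x = 0) \<and>
     pN 1 = 0"

definition normalized_solution ::
  "real \<Rightarrow> real \<Rightarrow> real \<Rightarrow> real \<Rightarrow> real \<Rightarrow> (real \<Rightarrow> real) \<Rightarrow> real \<Rightarrow> (real \<Rightarrow> real) \<Rightarrow> bool"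
  where
  "normalized_solution S lam mu xbar cN pN cW pW \<longleftrightarrow>
     stationary_fokker_planck S lam mu xbar cN pN cW pW \<and>
     cN \<ge> 0 \<and> cW \<ge> 0 \<and>
     continuous_on {0<..<1} pN \<and> continuous_on {0<..<1} pW \<and>
     (pN \<longlongrightarrow> lam / S * cN) (at_right 0) \<and>
     (pW \<longlongrightarrow> mu / S * cW - lam / S * cN) (at_right 0) \<and>
     mass (cN + cW) (\<lambda>x. pN x + pW x) 1 = 1"

end

theory Submission imports Defs
begin

text \<open>
  Off $0$, $\bar x$ and $1$ the flux is $-S$ times the density, so the system consists of linear
  equations with constant coefficients on two intervals, and it decouples if it is read from
  right to left. Take as parameter the waiting mass $m=\int_{[0,1]}p_W$, which drives the source
  at $x=1$. On $(\bar x,1)$ the density $p_N$ is constant, and the source fixes this constant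
  as $\mu m/S$. Continuity at $\bar x$ gives the terminal value of $p_N'=(\lambda/S)p_N$ on
  $(0,\bar x)$. With $p_N$ known, $p_W$ solves $p_W'=(\mu/S)p_W-(\lambda/S)p_N$ with terminal
  value $0$, because it vanishes beyond $\bar x$ and is continuous there. The boundary relations
  at $+0$ then read off $c_N$ and $c_W$. So every solution is the member with parameter $m$ of an
  explicit family (\<open>solution_imp_profile\<close>), linear in $m$.

  There remains the self-consistency of $m$. Integrating the explicit densities
  (\<open>profile_masses\<close>) shows that the waiting mass of the member with parameter $m$ is always $m$,
  so the nonlocal source imposes no condition, and that the total mass is
  $m\,(1+\mu/\lambda+\mu(1-\bar x)/S)$. Hence normalisation holds exactly for $m=c$.
  Conversely this member satisfies all the equations (\<open>profile_imp_solution\<close>), which gives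
  existence.
\<close>

section \<open>Linear equations and antiderivatives on an interval\<close>

text \<open>
  The terminal value enters only as a one-sided limit, since the density need not be
  differentiable at $\bar x$ and $p_N$ jumps at $1$. The product of \<open>f x\<close> with
  \<open>exp (- r * (x - b))\<close> has derivative $0$, so it equals its limit at \<open>b\<close>. The case \<open>r = 0\<close> covers
  the constant density beyond $\bar x$.
\<close>

lemma linear_ode_terminal_value:
  fixes f :: "real \<Rightarrow> real"
  assumes ode: "\<And>x. x \<in> {a<..<b} \<Longrightarrow> (f has_real_derivative r * f x) (at x)"
    and lim: "(f \<longlongrightarrow> C) (at_left b)"
    and x: "x \<in> {a<..<b}"
  shows "f x = C * exp (r * (x - b))"
proof -
  define g where "g = (\<lambda>x. f x * exp (- r * (x - b)))"
  have "(g has_real_derivative 0) (at y)" if "y \<in> {a<..<b}" for y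
    unfolding g_def by (rule derivative_eq_intros ode that refl | simp)+
  then have const: "g y = g x" if "y \<in> {a<..<b}" for y
    using DERIV_isconst3[of a b y x g] x that by auto
  have "((\<lambda>y. f y * exp (- r * (y - b))) \<longlongrightarrow> C * exp (- r * (b - b))) (at_left b)"
    by (intro tendsto_intros lim)
  then have "(g \<longlongrightarrow> C) (at_left b)" by (simp add: g_def)
  moreover have "\<forall>\<^sub>F y in at_left b. g y = g x"
    by (rule eventually_mono[OF eventually_at_left_real const]) (use x in auto)
  then have "(g \<longlongrightarrow> g x) (at_left b)" by (rule tendsto_eventually)
  ultimately have "g x = C"
    using tendsto_unique[of "at_left b" g] by auto
  then have "C * exp (r * (x - b)) = f x * (exp (- r * (x - b)) * exp (r * (x - b)))"
    by (simp add: g_def)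
  then show ?thesis by (simp add: mult_exp_exp)
qed

text \<open>
  Only the values on the open interval matter, the endpoints being a null set. This absorbs
  the convention $p_N(1)=0$.
\<close>

lemma FTC_Ioc:
  fixes p :: "real \<Rightarrow> real"
  assumes "a \<le> b"
    and deriv: "\<And>x. (P has_real_derivative f x) (at x)"
    and cont: "\<And>x. isCont f x"
    and eq: "\<forall>x\<in>{a<..<b}. p x = f x"
  shows "set_integrable lborel {a<..b} p" and "(LINT x:{a<..b}|lborel. p x) = P b - P a"
proof -
  have "has_bochner_integral lborel (\<lambda>x. f x * indicator {a..b} x) (P b - P a)"
    by (intro has_bochner_integral_FTC_Icc_real assms)
  then have "has_bochner_integral lborel (\<lambda>x. indicator {a<..b} x *\<^sub>R p x) (P b - P a)"
    by (rule has_bochner_integral_discrete_difference[where X="{a, b}", THEN iffD1, rotated 4])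
      (auto split: split_indicator simp: eq)
  then show "set_integrable lborel {a<..b} p" "(LINT x:{a<..b}|lborel. p x) = P b - P a"
    unfolding set_integrable_def set_lebesgue_integral_def has_bochner_integral_iff by auto
qed

lemma FTC_Ioc_split:
  fixes p :: "real \<Rightarrow> real"
  assumes "a \<le> m" "m \<le> b"
    and "\<And>x. (P has_real_derivative f x) (at x)" "\<And>x. isCont f x"
    and "\<forall>x\<in>{a<..<m}. p x = f x"
    and "\<forall>x\<in>{m<..<b}. p x = k"
  shows "set_integrable lborel {a<..b} p"
    and "(LINT x:{a<..b}|lborel. p x) = P m - P a + k * (b - m)"
proof -
  note l = FTC_Ioc[OF assms(1,3,4,5)]
  have "((\<lambda>x. k * x) has_real_derivative k) (at x)" for x
    by (auto intro!: derivative_eq_intros)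
  note r = FTC_Ioc[OF assms(2) this continuous_const assms(6)]
  have u: "{a<..b} = {a<..m} \<union> {m<..b}" using assms(1,2) by auto
  show "set_integrable lborel {a<..b} p"
    unfolding u by (intro set_integrable_Un l r) auto
  show "(LINT x:{a<..b}|lborel. p x) = P m - P a + k * (b - m)"
    unfolding u by (subst set_integral_Un) (auto simp: l r right_diff_distrib)
qed

text \<open>
  As $h\to+0$ only the Dirac weight survives in the mass on $[0,h]$, so the integral form of the
  equations at $0$ follows from the two relations between boundary values and Dirac weights.
\<close>

lemma mass_tendsto_dirac_weight:
  fixes p :: "real \<Rightarrow> real"
  assumes "0 < d"
    and deriv: "\<And>x. (P has_real_derivative f x) (at x)" and cont: "\<And>x. isCont f x"
    and eq: "\<And>x. x \<in> {0<..<d} \<Longrightarrow> p x = f x"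
  shows "(mass w p \<longlongrightarrow> w) (at_right 0)"
proof -
  have "isCont P 0" using deriv DERIV_isCont by blast
  then have "(P \<longlongrightarrow> P 0) (at_right 0)"
    using continuous_at_imp_continuous_at_within continuous_within by blast
  then have "((\<lambda>h. w + (P h - P 0)) \<longlongrightarrow> w + (P 0 - P 0)) (at_right 0)"
    by (intro tendsto_intros)
  then have lim: "((\<lambda>h. w + (P h - P 0)) \<longlongrightarrow> w) (at_right 0)" by simp
  have "mass w p h = w + (P h - P 0)" if "h \<in> {0<..<d}" for h
    using FTC_Ioc(2)[OF _ deriv cont, of 0 h p] eq that by (simp add: mass_def)
  then have "\<forall>\<^sub>F h in at_right 0. w + (P h - P 0) = mass w p h"
    using eventually_at_right_real[OF \<open>0 < d\<close>] by (auto elim!: eventually_mono)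
  then show ?thesis by (rule Lim_transform_eventually[OF lim])
qed

section \<open>The one-parameter family of stationary profiles\<close>

locale waiting_system =
  fixes S lam mu xbar :: real
  assumes S: "S > 0" and lam: "lam > 0" and mu: "mu > lam" and xbar: "0 < xbar" "xbar < 1"
begin

definition E where "E = (mu * exp (- lam / S * xbar) - lam * exp (- mu / S * xbar)) / (mu - lam)"
definition F where "F = lam * mu / (S * (mu - lam))"
definition c where "c = 1 / (1 + mu / lam + mu / S * (1 - xbar))"

text \<open>
  The two formulas valid on $(0,\bar x]$, extended to all reals so that they can be
  differentiated and evaluated at $0$ and $\bar x$ without one-sided care.
\<close>

definition branchN where "branchN m x = mu / S * m * exp (lam / S * (x - xbar))"
definition branchW where
  "branchW m x = F * m * (exp (lam / S * (x - xbar)) - exp (mu / S * (x - xbar)))"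

text \<open>
  The solution formulas with the waiting mass left as a free parameter \<open>m\<close> in place of \<open>c\<close>.
\<close>

definition profile where
  "profile m cN pN cW pW \<longleftrightarrow>
     cN = mu / lam * m * exp (- lam / S * xbar) \<and>
     (\<forall>x. 0 < x \<and> x \<le> xbar \<longrightarrow> pN x = branchN m x) \<and>
     (\<forall>x. xbar < x \<and> x \<le> 1 \<longrightarrow> pN x = mu / S * m * (1 - indicator {1} x)) \<and>
     cW = E * m \<and>
     (\<forall>x. 0 < x \<and> x \<le> xbar \<longrightarrow> pW x = branchW m x) \<and>
     (\<forall>x. xbar < x \<and> x \<le> 1 \<longrightarrow> pW x = 0)"

lemma mu_pos: "mu > 0" using lam mu by simp

lemma E_pos: "E > 0"
proof -
  have "- mu / S * xbar < - lam / S * xbar"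
    using S mu xbar by (intro mult_strict_right_mono divide_strict_right_mono) auto
  then have "lam * exp (- mu / S * xbar) < mu * exp (- lam / S * xbar)"
    using lam mu by (intro mult_strict_mono) auto
  then show ?thesis using mu by (simp add: E_def)
qed

lemma F_pos: "F > 0" using S lam mu by (simp add: F_def)

lemma c_pos: "c > 0"
  unfolding c_def using S lam mu xbar by (intro divide_pos_pos add_pos_nonneg) auto

lemma isCont_branches: "isCont (branchN m) x" "isCont (branchW m) x"
  unfolding branchN_def branchW_def using S by (auto intro!: continuous_intros)

lemma DERIV_branchN: "(branchN m has_real_derivative lam / S * branchN m x) (at x)"
  unfolding branchN_def using S by (auto intro!: derivative_eq_intros)

text \<open>
  The coefficient \<open>F\<close> is the one for which the term in $e^{\lambda(x-\bar x)/S}$ is a particular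
  solution; the term in $e^{\mu(x-\bar x)/S}$ solves the homogeneous equation.
\<close>

lemma DERIV_branchW:
  "(branchW m has_real_derivative mu / S * branchW m x - lam / S * branchN m x) (at x)"
proof -
  have "F * lam / S = mu / S * F - lam / S * (mu / S)"
    using S mu by (simp add: F_def field_simps)
  then have "m * (F * lam / S) = m * (mu / S * F - lam / S * (mu / S))" by (rule arg_cong)
  then have *: "F * m * (lam / S) = (mu / S * F - lam / S * (mu / S)) * m"
    by (simp add: mult_ac)
  have "(branchW m has_real_derivative F * m * (lam / S) * exp (lam / S * (x - xbar))
      - F * m * (mu / S) * exp (mu / S * (x - xbar))) (at x)"
    unfolding branchW_def using S
    by (auto intro!: derivative_eq_intros simp: algebra_simps)
  then show ?thesis
    unfolding * branchN_def branchW_def by (simp add: algebra_simps)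
qed

lemma antiderivative_branchN:
  "((\<lambda>x. S / lam * branchN m x) has_real_derivative branchN m x) (at x)"
  using DERIV_cmult[OF DERIV_branchN, of "S / lam"] S lam by (simp add: field_simps)

text \<open>
  Adding the two differential equations cancels the exchange term $\lambda p_N$, leaving
  $(p_W+p_N)'=(\mu/S)p_W$.
\<close>

lemma antiderivative_branchW:
  "((\<lambda>x. S / mu * (branchW m x + branchN m x)) has_real_derivative branchW m x) (at x)"
proof -
  have "((\<lambda>x. S / mu * (branchW m x + branchN m x)) has_real_derivative
    S / mu * (mu / S * branchW m x - lam / S * branchN m x + lam / S * branchN m x)) (at x)"
    by (intro DERIV_cmult DERIV_add DERIV_branchN DERIV_branchW)
  then show ?thesis using S mu_pos by simp
qed

lemma branch_at_xbar: "branchN m xbar = mu / S * m" "branchW m xbar = 0"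
  by (simp_all add: branchN_def branchW_def)

text \<open>
  The values at $0$ are exactly those that the boundary relations assign to the Dirac weights of
  a profile; for the waiting density this is the identity behind the formula for \<open>E\<close>.
\<close>

lemma branchN_at_0: "branchN m 0 = lam / S * (mu / lam * m * exp (- lam / S * xbar))"
  using lam by (simp add: branchN_def)

lemma branchW_at_0: "branchW m 0 = mu / S * (E * m) - branchN m 0"
proof -
  define u v where "u = exp (- lam / S * xbar)" and "v = exp (- mu / S * xbar)"
  have "lam * mu / (S * (mu - lam)) * (u - v) = mu / S * ((mu * u - lam * v) / (mu - lam)) - mu / S * u"
    using S mu by (simp add: divide_simps) (simp add: algebra_simps)
  then have "F * (u - v) = mu / S * E - mu / S * u"
    unfolding E_def F_def u_def v_def .
  then have "m * (F * (u - v)) = m * (mu / S * E - mu / S * u)" by simp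
  then show ?thesis
    by (simp add: branchN_def branchW_def u_def v_def algebra_simps)
qed

text \<open>
  The Dirac weight equals the value at $0$ of the antiderivative of the density, so it cancels
  against the lower limit of the integral, and each mass depends only on what happens at and
  beyond $\bar x$. In particular the waiting mass reproduces the parameter.
\<close>

lemma profile_masses:
  assumes "profile m cN pN cW pW"
  shows "set_integrable lborel {0<..1} pN" "set_integrable lborel {0<..1} pW"
    and "mass cN pN 1 = m * (mu / lam + mu / S * (1 - xbar))" "mass cW pW 1 = m"
proof -
  have N: "\<forall>x\<in>{0<..<xbar}. pN x = branchN m x"
    using assms by (auto simp: profile_def)
  have N': "\<forall>x\<in>{xbar<..<1}. pN x = mu / S * m"
    using assms by (auto simp: profile_def)
  have W: "\<forall>x\<in>{0<..<xbar}. pW x = branchW m x"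
    using assms by (auto simp: profile_def)
  have W': "\<forall>x\<in>{xbar<..<1}. pW x = 0"
    using assms by (auto simp: profile_def)
  have x: "0 \<le> xbar" "xbar \<le> 1" using xbar by auto
  note iN = FTC_Ioc_split[OF x antiderivative_branchN isCont_branches(1) N N']
  note iW = FTC_Ioc_split[OF x antiderivative_branchW isCont_branches(2) W W']
  show "set_integrable lborel {0<..1} pN" "set_integrable lborel {0<..1} pW"
    by (fact iN(1) iW(1))+
  have cN: "cN = S / lam * branchN m 0"
    using assms S lam by (simp add: profile_def branchN_at_0)
  then show "mass cN pN 1 = m * (mu / lam + mu / S * (1 - xbar))"
    using S lam by (simp add: mass_def iN(2) branch_at_xbar field_simps)
  have "cW = S / mu * (branchW m 0 + branchN m 0)"
    using assms S mu_pos by (simp add: profile_def branchW_at_0)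
  then show "mass cW pW 1 = m"
    using S mu_pos by (simp add: mass_def iW(2) branch_at_xbar)
qed

section \<open>Every solution is a profile\<close>

lemma DERIV_flux_iff:
  assumes "x \<in> {0<..<1}"
  shows "(flux S p has_real_derivative D) (at x) \<longleftrightarrow> (p has_real_derivative - D / S) (at x)"
proof
  assume "(flux S p has_real_derivative D) (at x)"
  then have "((\<lambda>y. (- 1 / S) * flux S p y) has_real_derivative (- 1 / S) * D) (at x)"
    by (rule DERIV_cmult)
  then have "((\<lambda>y. (- 1 / S) * flux S p y) has_real_derivative - D / S) (at x)" by simp
  then show "(p has_real_derivative - D / S) (at x)"
    by (rule has_field_derivative_transform_within_open[where S="{0<..<1}"])
      (use assms S in \<open>auto simp: flux_def\<close>)
next
  assume "(p has_real_derivative - D / S) (at x)"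
  then have "((\<lambda>y. (- S) * p y) has_real_derivative (- S) * (- D / S)) (at x)"
    by (rule DERIV_cmult)
  then have "((\<lambda>y. (- S) * p y) has_real_derivative D) (at x)" using S by simp
  then show "(flux S p has_real_derivative D) (at x)"
    by (rule has_field_derivative_transform_within_open[where S="{0<..<1}"])
      (use assms in \<open>auto simp: flux_def\<close>)
qed

lemma tendsto_at_right_0_branch:
  fixes p f :: "real \<Rightarrow> real"
  assumes "isCont f 0" and eq: "\<And>x. x \<in> {0<..<xbar} \<Longrightarrow> p x = f x"
  shows "(p \<longlongrightarrow> f 0) (at_right 0)"
proof (rule Lim_transform_eventually)
  show "(f \<longlongrightarrow> f 0) (at_right 0)"
    using assms(1) continuous_at_imp_continuous_at_within continuous_within by blast
  show "\<forall>\<^sub>F x in at_right 0. f x = p x"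
    by (rule eventually_mono[OF eventually_at_right_real[OF xbar(1)]]) (use eq in auto)
qed

text \<open>
  The source at $1$, continuity at $\bar x$ and the relations at $+0$ determine, in this order,
  the constant part, both terminal value problems on $(0,\bar x)$, and the Dirac weights.
\<close>

lemma solution_imp_profile:
  assumes "normalized_solution S lam mu xbar cN pN cW pW"
  shows "profile (mass cW pW 1) cN pN cW pW"
proof -
  define m where "m = mass cW pW 1"
  from assms have
    odeN: "\<And>x. x \<in> {0<..<xbar} \<Longrightarrow>
      \<exists>D. (flux S pN has_real_derivative D) (at x) \<and> D + lam * pN x = 0"
    and const: "\<And>x. x \<in> {xbar<..<1} \<Longrightarrow> (flux S pN has_real_derivative 0) (at x)"
    and end1: "((\<lambda>x. S * pN x) \<longlongrightarrow> mu * m) (at_left 1)"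
    and odeW: "\<And>x. x \<in> {0<..<xbar} \<Longrightarrow>
      \<exists>D. (flux S pW has_real_derivative D) (at x) \<and> D + mu * pW x - lam * pN x = 0"
    and W0: "\<And>x. x \<in> {xbar<..1} \<Longrightarrow> pW x = 0" and N1: "pN 1 = 0"
    and contN: "continuous_on {0<..<1} pN" and contW: "continuous_on {0<..<1} pW"
    and limN: "(pN \<longlongrightarrow> lam / S * cN) (at_right 0)"
    and limW: "(pW \<longlongrightarrow> mu / S * cW - lam / S * cN) (at_right 0)"
    unfolding normalized_solution_def stationary_fokker_planck_def m_def by blast+
  have "isCont pN xbar" "isCont pW xbar"
    using contN contW xbar by (auto simp: continuous_on_eq_continuous_at)
  then have cont: "(pN \<longlongrightarrow> pN xbar) (at_left xbar)" "(pN \<longlongrightarrow> pN xbar) (at_right xbar)"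
     "(pW \<longlongrightarrow> pW xbar) (at_left xbar)" "(pW \<longlongrightarrow> pW xbar) (at_right xbar)"
    using continuous_at_imp_continuous_at_within continuous_within by blast+
  have right: "\<forall>\<^sub>F x in at_right xbar. x \<in> {xbar<..<1}"
    using eventually_at_right_real[OF xbar(2)] .

  \<comment> \<open>The source at $1$ is the terminal value for the constant density beyond $\bar x$.\<close>
  have "((\<lambda>x. (S * pN x) / S) \<longlongrightarrow> mu * m / S) (at_left 1)"
    by (intro tendsto_divide end1 tendsto_const) (use S in simp)
  then have lim1: "(pN \<longlongrightarrow> mu / S * m) (at_left 1)" using S by simp
  have N_right: "pN x = mu / S * m" if "x \<in> {xbar<..<1}" for x
  proof -
    have "(pN has_real_derivative 0 * pN y) (at y)" if "y \<in> {xbar<..<1}" for y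
      using const[OF that] DERIV_flux_iff[of y pN 0] xbar that by simp
    from linear_ode_terminal_value[OF this lim1 that] show ?thesis by simp
  qed
  then have "(pN \<longlongrightarrow> mu / S * m) (at_right xbar)"
    by (intro tendsto_eventually eventually_mono[OF right])
  with cont(2) have N_xbar: "pN xbar = mu / S * m"
    using tendsto_unique[of "at_right xbar" pN] by auto
  have dN: "(pN has_real_derivative lam / S * pN x) (at x)" if x: "x \<in> {0<..<xbar}" for x
  proof -
    obtain D where "(flux S pN has_real_derivative D) (at x)" and D: "D + lam * pN x = 0"
      using odeN[OF x] by blast
    moreover have "- D = lam * pN x" using D by simp
    ultimately show ?thesis using DERIV_flux_iff[of x pN D] x xbar by simp
  qed
  have N_left: "pN x = branchN m x" if "x \<in> {0<..<xbar}" for x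
    using linear_ode_terminal_value[OF dN cont(1) that] by (simp add: branchN_def N_xbar)

  have "(pW \<longlongrightarrow> 0) (at_right xbar)"
    by (rule tendsto_eventually, rule eventually_mono[OF right]) (use W0 in auto)
  with cont(4) have W_xbar: "pW xbar = 0"
    using tendsto_unique[of "at_right xbar" pW] by auto
  have dW: "(pW has_real_derivative mu / S * pW x - lam / S * branchN m x) (at x)"
    if x: "x \<in> {0<..<xbar}" for x
  proof -
    obtain D where "(flux S pW has_real_derivative D) (at x)" and
      D: "D + mu * pW x - lam * pN x = 0"
      using odeW[OF x] by blast
    then have "(pW has_real_derivative - D / S) (at x)"
      using DERIV_flux_iff[of x pW D] x xbar by simp
    moreover have "- D = mu * pW x - lam * branchN m x" using D N_left[OF x] by simp
    ultimately show ?thesis by (simp add: diff_divide_distrib)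
  qed
  have W_left: "pW x = branchW m x" if "x \<in> {0<..<xbar}" for x
  proof -
    \<comment> \<open>The difference of two solutions solves the homogeneous equation with terminal value 0.\<close>
    have "((\<lambda>x. pW x - branchW m x) has_real_derivative mu / S * (pW y - branchW m y)) (at y)"
      if "y \<in> {0<..<xbar}" for y
      using DERIV_diff[OF dW[OF that] DERIV_branchW[of m y]] by (simp add: algebra_simps)
    moreover have "(branchW m \<longlongrightarrow> branchW m xbar) (at_left xbar)"
      using isCont_branches(2) continuous_at_imp_continuous_at_within continuous_within by blast
    then have "((\<lambda>x. pW x - branchW m x) \<longlongrightarrow> pW xbar - branchW m xbar) (at_left xbar)"
      by (intro tendsto_diff cont)
    then have "((\<lambda>x. pW x - branchW m x) \<longlongrightarrow> 0) (at_left xbar)"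
      by (simp add: W_xbar branch_at_xbar)
    ultimately have "pW x - branchW m x = 0 * exp (mu / S * (x - xbar))"
      using that by (rule linear_ode_terminal_value)
    then show ?thesis by simp
  qed

  have "branchN m 0 = lam / S * cN"
    by (rule tendsto_unique[OF _ tendsto_at_right_0_branch[OF isCont_branches(1) N_left] limN]) simp
  then have cN: "cN = mu / lam * m * exp (- lam / S * xbar)"
    using S lam by (simp add: branchN_at_0)
  have "branchW m 0 = mu / S * cW - lam / S * cN"
    by (rule tendsto_unique[OF _ tendsto_at_right_0_branch[OF isCont_branches(2) W_left] limW]) simp
  then have cW: "cW = E * m"
    using \<open>branchN m 0 = lam / S * cN\<close> S mu_pos by (simp add: branchW_at_0)
  show ?thesis
    unfolding profile_def m_def[symmetric]
    using cN cW N_left W_left N_right N_xbar W_xbar W0 N1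
    by (auto simp: branch_at_xbar indicator_def order.order_iff_strict)
qed

section \<open>The normalised profile is a solution\<close>

text \<open>
  Continuity at $\bar x$ comes from writing both densities on $(0,1)$ as a branch evaluated at
  $\min(x,\bar x)$. The integral equations at $0$ hold because the flux tends to $-S$ times the
  boundary value while the mass tends to the Dirac weight.
\<close>

lemma profile_imp_solution:
  assumes prof: "profile c cN pN cW pW"
  shows "normalized_solution S lam mu xbar cN pN cW pW"
proof -
  from prof have cN: "cN = mu / lam * c * exp (- lam / S * xbar)" and cW: "cW = E * c"
    by (auto simp: profile_def)
  have N: "pN x = branchN c x" and W: "pW x = branchW c x" if "x \<in> {0<..<xbar}" for x
    using prof that by (auto simp: profile_def)
  have N': "pN x = mu / S * c" if "x \<in> {xbar<..<1}" for x
    using prof that by (auto simp: profile_def)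
  have glueN: "pN x = branchN c (min x xbar)" and glueW: "pW x = branchW c (min x xbar)"
    if "x \<in> {0<..<1}" for x
    using prof that branch_at_xbar by (auto simp: profile_def min_def)
  have contN: "continuous_on {0<..<1} pN"
  proof -
    have "continuous_on {0<..<1} (\<lambda>x. branchN c (min x xbar))"
      unfolding branchN_def by (intro continuous_intros)
    then show ?thesis by (rule continuous_on_eq) (simp add: glueN)
  qed
  have contW: "continuous_on {0<..<1} pW"
  proof -
    have "continuous_on {0<..<1} (\<lambda>x. branchW c (min x xbar))"
      unfolding branchW_def by (intro continuous_intros)
    then show ?thesis by (rule continuous_on_eq) (simp add: glueW)
  qed
  have near0: "\<forall>\<^sub>F x in at_right 0. x \<in> {0<..<xbar}"
    using eventually_at_right_real[OF xbar(1)] .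
  have b0: "branchN c 0 = lam / S * cN" "branchW c 0 = mu / S * cW - lam / S * cN"
    using branchN_at_0 branchW_at_0 cN cW by auto
  have limN: "(pN \<longlongrightarrow> lam / S * cN) (at_right 0)"
    using tendsto_at_right_0_branch[OF isCont_branches(1) N] by (simp only: b0)
  have limW: "(pW \<longlongrightarrow> mu / S * cW - lam / S * cN) (at_right 0)"
    using tendsto_at_right_0_branch[OF isCont_branches(2) W] by (simp only: b0)
  have massN: "(mass cN pN \<longlongrightarrow> cN) (at_right 0)"
    by (rule mass_tendsto_dirac_weight[OF xbar(1) antiderivative_branchN isCont_branches(1) N])
  have massW: "(mass cW pW \<longlongrightarrow> cW) (at_right 0)"
    by (rule mass_tendsto_dirac_weight[OF xbar(1) antiderivative_branchW isCont_branches(2) W])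
  have lim_flux: "((\<lambda>h. flux S p h - flux S p 0) \<longlongrightarrow> - S * l) (at_right 0)"
    if "(p \<longlongrightarrow> l) (at_right 0)" for p l
  proof (rule Lim_transform_eventually)
    show "((\<lambda>h. - S * p h) \<longlongrightarrow> - S * l) (at_right 0)" by (intro tendsto_intros that)
    show "\<forall>\<^sub>F h in at_right 0. - S * p h = flux S p h - flux S p 0"
      by (rule eventually_mono[OF near0]) (use xbar in \<open>auto simp: flux_def\<close>)
  qed

  note masses = profile_masses[OF prof]
  have "((\<lambda>h. flux S pN h - flux S pN 0 + lam * mass cN pN h) \<longlongrightarrow>
      - S * (lam / S * cN) + lam * cN) (at_right 0)"
    by (intro tendsto_intros lim_flux limN massN)
  then have bc0N: "((\<lambda>h. flux S pN h - flux S pN 0 + lam * mass cN pN h) \<longlongrightarrow> 0) (at_right 0)"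
    using S by simp
  have "((\<lambda>h. flux S pW h - flux S pW 0 + mu * mass cW pW h - lam * mass cN pN h) \<longlongrightarrow>
      - S * (mu / S * cW - lam / S * cN) + mu * cW - lam * cN) (at_right 0)"
    by (intro tendsto_intros lim_flux limW massN massW)
  then have bc0W: "((\<lambda>h. flux S pW h - flux S pW 0 + mu * mass cW pW h - lam * mass cN pN h)
      \<longlongrightarrow> 0) (at_right 0)"
    using S by (simp add: algebra_simps)

  have odeN: "\<exists>D. (flux S pN has_real_derivative D) (at x) \<and> D + lam * pN x = 0"
    if x: "x \<in> {0<..<xbar}" for x
  proof -
    have "(pN has_real_derivative lam / S * branchN c x) (at x)"
      by (rule has_field_derivative_transform_within_open[OF DERIV_branchN, where S="{0<..<xbar}"])
        (use x N in auto)
    then have "(flux S pN has_real_derivative - lam * pN x) (at x)"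
      using x xbar N[OF x] by (subst DERIV_flux_iff) auto
    then show ?thesis by (intro exI[of _ "- lam * pN x"]) auto
  qed
  have odeW: "\<exists>D. (flux S pW has_real_derivative D) (at x) \<and> D + mu * pW x - lam * pN x = 0"
    if x: "x \<in> {0<..<xbar}" for x
  proof -
    have "(pW has_real_derivative mu / S * branchW c x - lam / S * branchN c x) (at x)"
      by (rule has_field_derivative_transform_within_open[OF DERIV_branchW, where S="{0<..<xbar}"])
        (use x W in auto)
    then have "(flux S pW has_real_derivative lam * pN x - mu * pW x) (at x)"
      using x xbar N[OF x] W[OF x] by (subst DERIV_flux_iff) (auto simp: diff_divide_distrib)
    then show ?thesis by (intro exI[of _ "lam * pN x - mu * pW x"]) auto
  qed
  have const: "(flux S pN has_real_derivative 0) (at x)" if x: "x \<in> {xbar<..<1}" for x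
  proof -
    have "(pN has_real_derivative 0) (at x)"
      by (rule has_field_derivative_transform_within_open[OF DERIV_const, where S="{xbar<..<1}"])
        (use x N' in auto)
    then show ?thesis using x xbar by (subst DERIV_flux_iff) auto
  qed
  have "\<forall>\<^sub>F x in at_left 1. S * pN x = mu * c"
    by (rule eventually_mono[OF eventually_at_left_real[OF xbar(2)]]) (use N' S in auto)
  then have end1: "((\<lambda>x. S * pN x) \<longlongrightarrow> mu * mass cW pW 1) (at_left 1)"
    unfolding masses(4) by (rule tendsto_eventually)
  have "pN 1 = 0" "\<forall>x\<in>{xbar<..1}. pW x = 0"
    using prof xbar by (auto simp: profile_def)
  moreover have "cN \<ge> 0" "cW \<ge> 0"
    using cN cW lam mu_pos c_pos E_pos by auto
  moreover have "mass (cN + cW) (\<lambda>x. pN x + pW x) 1 = mass cN pN 1 + mass cW pW 1"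
    using masses(1,2) by (simp add: mass_def)
  then have "mass (cN + cW) (\<lambda>x. pN x + pW x) 1 = c * (1 + mu / lam + mu / S * (1 - xbar))"
    unfolding masses by (simp add: algebra_simps)
  then have "mass (cN + cW) (\<lambda>x. pN x + pW x) 1 = 1"
    using c_pos by (auto simp: c_def)
  ultimately show ?thesis
    unfolding normalized_solution_def stationary_fokker_planck_def
    using masses(1,2) odeN bc0N const end1 odeW bc0W contN contW limN limW by blast
qed

text \<open>
  For a solution with waiting mass $m$ the total mass is $m/c$, so total mass one forces $m=c$.
\<close>

lemma normalized_solution_iff_profile:
  "normalized_solution S lam mu xbar cN pN cW pW \<longleftrightarrow> profile c cN pN cW pW"
proof
  assume sol: "normalized_solution S lam mu xbar cN pN cW pW"
  define m where "m = mass cW pW 1"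
  have prof: "profile m cN pN cW pW"
    unfolding m_def by (rule solution_imp_profile[OF sol])
  note masses = profile_masses[OF prof]
  have "1 = mass (cN + cW) (\<lambda>x. pN x + pW x) 1"
    using sol by (simp add: normalized_solution_def)
  also have "\<dots> = mass cN pN 1 + mass cW pW 1"
    using masses(1,2) by (simp add: mass_def)
  also have "\<dots> = m * (1 + mu / lam + mu / S * (1 - xbar))"
    unfolding masses by (simp add: algebra_simps)
  finally have "m = c"
    by (simp add: c_def) (metis mult_zero_right nonzero_eq_divide_eq zero_neq_one)
  with prof show "profile c cN pN cW pW" by simp
qed (rule profile_imp_solution)

lemma profile_exists: "\<exists>cN pN cW pW. profile m cN pN cW pW"
proof -
  have "profile m (mu / lam * m * exp (- lam / S * xbar))
      (\<lambda>x. if x \<le> xbar then branchN m x else mu / S * m * (1 - indicator {1} x))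
      (E * m) (\<lambda>x. if x \<le> xbar then branchW m x else 0)"
    by (simp add: profile_def)
  then show ?thesis by blast
qed

end

theorem proposition2:
  fixes S lam mu xbar E F c :: real
  assumes "S > 0" and "lam > 0" and "mu > lam" and "0 < xbar" and "xbar < 1"
    and E: "E = (mu * exp (- lam / S * xbar) - lam * exp (- mu / S * xbar)) / (mu - lam)"
    and F: "F = lam * mu / (S * (mu - lam))"
    and c: "c = 1 / (1 + mu / lam + mu / S * (1 - xbar))"
  shows "E > 0 \<and> F > 0 \<and> c > 0 \<and>
    (\<exists>cN pN cW pW. normalized_solution S lam mu xbar cN pN cW pW) \<and>
    (\<forall>cN pN cW pW. normalized_solution S lam mu xbar cN pN cW pW \<longrightarrow>
       mass cW pW 1 = c \<and>
       cN = mu / lam * c * exp (- lam / S * xbar) \<and>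
       (\<forall>x. 0 < x \<and> x \<le> xbar \<longrightarrow> pN x = mu / S * c * exp (lam / S * (x - xbar))) \<and>
       (\<forall>x. xbar < x \<and> x \<le> 1 \<longrightarrow> pN x = mu / S * c * (1 - indicator {1} x)) \<and>
       cW = E * c \<and>
       (\<forall>x. 0 < x \<and> x \<le> xbar \<longrightarrow>
          pW x = F * c * (exp (lam / S * (x - xbar)) - exp (mu / S * (x - xbar)))) \<and>
       (\<forall>x. xbar < x \<and> x \<le> 1 \<longrightarrow> pW x = 0))"
proof -
  interpret W: waiting_system S lam mu xbar
    using assms by unfold_locales auto
  have eqs: "E = W.E" "F = W.F" "c = W.c"
    by (simp_all add: E F c W.E_def W.F_def W.c_def)
  show ?thesis
    unfolding W.normalized_solution_iff_profile eqs
  proof (intro conjI allI impI W.E_pos W.F_pos W.c_pos W.profile_exists)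
    fix cN pN cW pW
    assume prof: "W.profile W.c cN pN cW pW"
    show "mass cW pW 1 = W.c" by (rule W.profile_masses(4)[OF prof])
  qed (auto simp: W.profile_def W.branchN_def W.branchW_def)
qed

end
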